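(* Let $n\ge2$, $m=n-1$, let $\Omega\subset\mathbb R^n$ be open, let $u\in H^2_{\mathrm{loc}}(\Omega)$, and suppose that $Lu=g$ almost everywhere in $\Omega$. At $x=r\theta\in\Omega\setminus\{0\}$ (with $r=|x|$, $\theta=x/|x|$) let $$u_r(r\theta)=\partial_r[u(r\theta)],\qquad u_{rr}(r\theta)=\partial_r^2[u(r\theta)]$$ denote the radial derivatives. Then, almost everywhere in $\Omega$, $$\|\nabla^2u\|_{\mathrm{HS}}^2+|\nabla u|^2\ \ge\ u_{rr}^2+u_r^2+\frac{(g+ru_r-u_{rr})^2}{m}.$$
   Context: $Lu=\Delta u-\langle x,\nabla u\rangle$ is the Ornstein--Uhlenbeck operator, $\nabla^2u$ is the Euclidean Hessian (weak second derivatives) and $\|\cdot\|_{\mathrm{HS}}$ is the Hilbert--Schmidt norm. For $u\in H^2_{\mathrm{loc}}$ the radial derivatives are, almost everywhere, $u_r=\langle\nabla u,\theta\rangle$ and $u_{rr}=\langle\nabla^2u\,\theta,\theta\rangle$. *)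

theory Defs
  imports "HOL-Analysis.Analysis"
begin

primrec Ck :: "nat \<Rightarrow> (real^'n \<Rightarrow> real) \<Rightarrow> bool" where
  "Ck 0 f \<longleftrightarrow> continuous_on UNIV f"
| "Ck (Suc k) f \<longleftrightarrow> (\<exists>G. (\<forall>x. GDERIV f x :> G x) \<and> (\<forall>i. Ck k (\<lambda>x. G x $ i)))"

definition test_function :: "(real^'n) set \<Rightarrow> (real^'n \<Rightarrow> real) \<Rightarrow> bool" where
  "test_function \<Omega> \<phi> \<longleftrightarrow>
     (\<forall>k. Ck k \<phi>) \<and> compact (closure {x. \<phi> x \<noteq> 0}) \<and> closure {x. \<phi> x \<noteq> 0} \<subseteq> \<Omega>"

definition partial_deriv :: "'n \<Rightarrow> (real^'n \<Rightarrow> real) \<Rightarrow> real^'n \<Rightarrow> real" where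
  "partial_deriv i \<phi> x = frechet_derivative \<phi> (at x) (axis i 1)"

definition L1_loc :: "(real^'n) set \<Rightarrow> (real^'n \<Rightarrow> real) set" where
  "L1_loc \<Omega> = {f. f \<in> borel_measurable (lebesgue_on \<Omega>) \<and>
     (\<forall>K. compact K \<and> K \<subseteq> \<Omega> \<longrightarrow> integrable (lebesgue_on K) f)}"

definition L2_loc :: "(real^'n) set \<Rightarrow> (real^'n \<Rightarrow> real) set" where
  "L2_loc \<Omega> = {f. f \<in> borel_measurable (lebesgue_on \<Omega>) \<and>
     (\<forall>K. compact K \<and> K \<subseteq> \<Omega> \<longrightarrow> integrable (lebesgue_on K) (\<lambda>x. (f x)\<^sup>2))}"

text \<open>Local integrability is part of the definition: the Bochner integral of a
  non-integrable function is \<open>0\<close>, so the integral identity alone would say too little.\<close>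

definition weak_partial ::
  "(real^'n) set \<Rightarrow> 'n \<Rightarrow> (real^'n \<Rightarrow> real) \<Rightarrow> (real^'n \<Rightarrow> real) \<Rightarrow> bool" where
  "weak_partial \<Omega> i u v \<longleftrightarrow> u \<in> L1_loc \<Omega> \<and> v \<in> L1_loc \<Omega> \<and>
     (\<forall>\<phi>. test_function \<Omega> \<phi> \<longrightarrow>
        (\<integral>x. u x * partial_deriv i \<phi> x \<partial>lebesgue_on \<Omega>) =
        - (\<integral>x. v x * \<phi> x \<partial>lebesgue_on \<Omega>))"

text \<open>Weak derivatives are determined only up to null sets, so the gradient and the Hessian
  are relations between a function and one version of its derivatives. In the Hessian,
  the entry \<open>D2u x $ i $ j\<close> is the derivative in direction \<open>j\<close> of the \<open>i\<close>-th partial derivative.\<close>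

definition weak_gradient ::
  "(real^'n) set \<Rightarrow> (real^'n \<Rightarrow> real) \<Rightarrow> (real^'n \<Rightarrow> real^'n) \<Rightarrow> bool" where
  "weak_gradient \<Omega> u Du \<longleftrightarrow> (\<forall>i. weak_partial \<Omega> i u (\<lambda>x. Du x $ i))"

definition weak_hessian ::
  "(real^'n) set \<Rightarrow> (real^'n \<Rightarrow> real) \<Rightarrow> (real^'n \<Rightarrow> real^'n^'n) \<Rightarrow> bool" where
  "weak_hessian \<Omega> u D2u \<longleftrightarrow> (\<exists>Du. weak_gradient \<Omega> u Du \<and>
     (\<forall>i j. weak_partial \<Omega> j (\<lambda>x. Du x $ i) (\<lambda>x. D2u x $ i $ j)))"

definition H2_loc :: "(real^'n) set \<Rightarrow> (real^'n \<Rightarrow> real) set" where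
  "H2_loc \<Omega> = {u. u \<in> L2_loc \<Omega> \<and>
     (\<exists>Du. weak_gradient \<Omega> u Du \<and> (\<forall>i. (\<lambda>x. Du x $ i) \<in> L2_loc \<Omega>)) \<and>
     (\<exists>D2u. weak_hessian \<Omega> u D2u \<and> (\<forall>i j. (\<lambda>x. D2u x $ i $ j) \<in> L2_loc \<Omega>))}"

definition hs_norm :: "real^'n^'n \<Rightarrow> real" where
  "hs_norm A = sqrt (\<Sum>i\<in>UNIV. \<Sum>j\<in>UNIV. (A $ i $ j)\<^sup>2)"

text \<open>The Ornstein--Uhlenbeck operator \<open>Lu = \<Delta>u - \<langle>x, \<nabla>u\<rangle>\<close>, applied to given versions of
  the gradient and the Hessian of \<open>u\<close>.\<close>

definition OU :: "(real^'n \<Rightarrow> real^'n) \<Rightarrow> (real^'n \<Rightarrow> real^'n^'n) \<Rightarrow> real^'n \<Rightarrow> real" where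
  "OU Du D2u x = trace (D2u x) - x \<bullet> Du x"

text \<open>For a weakly differentiable \<open>u\<close> the radial derivatives are \<open>u\<^sub>r = \<langle>\<nabla>u, \<theta>\<rangle>\<close> and
  \<open>u\<^sub>r\<^sub>r = \<langle>\<nabla>\<^sup>2u \<theta>, \<theta>\<rangle>\<close> with \<open>\<theta> = x / |x| = sgn x\<close>; both are set to \<open>0\<close> at the origin.
  The two lemmas show that they are \<open>\<partial>\<^sub>r[u(r\<theta>)]\<close> and \<open>\<partial>\<^sub>r\<^sup>2[u(r\<theta>)]\<close> wherever
  \<open>Du\<close> and \<open>D2u\<close> are classical derivatives.\<close>

definition radial_deriv :: "(real^'n \<Rightarrow> real^'n) \<Rightarrow> real^'n \<Rightarrow> real" where
  "radial_deriv Du x = Du x \<bullet> sgn x"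

definition radial_deriv2 :: "(real^'n \<Rightarrow> real^'n^'n) \<Rightarrow> real^'n \<Rightarrow> real" where
  "radial_deriv2 D2u x = (D2u x *v sgn x) \<bullet> sgn x"

lemma radial_deriv_classical:
  assumes "GDERIV u x :> Du x" and "x \<noteq> 0"
  shows "((\<lambda>r. u (r *\<^sub>R sgn x)) has_real_derivative radial_deriv Du x) (at (norm x))"
proof -
  have x: "norm x *\<^sub>R sgn x = x"
    using assms(2) by (simp add: sgn_div_norm)
  have 1: "((\<lambda>r. r *\<^sub>R sgn x) has_derivative (\<lambda>h. h *\<^sub>R sgn x)) (at (norm x))"
    by (auto intro!: derivative_eq_intros)
  have 2: "(u has_derivative (\<lambda>h. h \<bullet> Du x)) (at (norm x *\<^sub>R sgn x))"
    using assms(1) unfolding gderiv_def x by simp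
  show ?thesis
    using has_derivative_compose[OF 1 2]
    by (simp add: has_field_derivative_def radial_deriv_def inner_commute mult_commute_abs)
qed

lemma radial_deriv2_classical:
  assumes "(Du has_derivative (\<lambda>h. D2u x *v h)) (at x)" and "x \<noteq> 0"
  shows "((\<lambda>r. radial_deriv Du (r *\<^sub>R sgn x)) has_real_derivative radial_deriv2 D2u x) (at (norm x))"
proof -
  have x: "norm x *\<^sub>R sgn x = x"
    using assms(2) by (simp add: sgn_div_norm)
  have 1: "((\<lambda>r. r *\<^sub>R sgn x) has_derivative (\<lambda>h. h *\<^sub>R sgn x)) (at (norm x))"
    by (auto intro!: derivative_eq_intros)
  have 2: "(Du has_derivative (\<lambda>h. D2u x *v h)) (at (norm x *\<^sub>R sgn x))"
    using assms(1) unfolding x .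
  have 3: "((\<lambda>r. Du (r *\<^sub>R sgn x) \<bullet> sgn x) has_derivative
      (\<lambda>h. (D2u x *v (h *\<^sub>R sgn x)) \<bullet> sgn x)) (at (norm x))"
    by (rule has_derivative_inner_left[OF has_derivative_compose[OF 1 2]])
  have 4: "((\<lambda>r. Du (r *\<^sub>R sgn x) \<bullet> sgn x) has_real_derivative radial_deriv2 D2u x) (at (norm x))"
    using 3 by (simp add: has_field_derivative_def radial_deriv2_def
        matrix_vector_mult_scaleR mult_commute_abs)
  show ?thesis
  proof (rule has_field_derivative_transform_within_open[OF 4])
    show "open {0::real<..}" "norm x \<in> {0<..}"
      using assms(2) by auto
    fix r :: real assume "r \<in> {0<..}"
    then show "Du (r *\<^sub>R sgn x) \<bullet> sgn x = radial_deriv Du (r *\<^sub>R sgn x)"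
      using assms(2) by (simp add: radial_deriv_def sgn_scaleR sgn_div_norm[of "sgn x"] norm_sgn)
  qed
qed

end

theory Submission
  imports Defs
begin

text \<open>The inequality holds pointwise, at every \<open>x \<noteq> 0\<close> with \<open>Lu = g\<close>, as a statement about
  a single matrix \<open>A = \<nabla>\<^sup>2u(x)\<close> and a single vector \<open>\<nabla>u(x)\<close>. With \<open>\<theta> = x / |x|\<close> the drift
  \<open>\<langle>x, \<nabla>u\<rangle>\<close> is \<open>r u\<^sub>r\<close>, so the equation turns the numerator on the right into the trace of \<open>A\<close>
  on the hyperplane orthogonal to \<open>\<theta>\<close>: \<open>g + r u\<^sub>r - u\<^sub>r\<^sub>r = tr A - \<langle>A\<theta>, \<theta>\<rangle>\<close>.
  In the Hilbert--Schmidt inner product, \<open>\<langle>A\<theta>, \<theta>\<rangle>\<close> and \<open>tr A - \<langle>A\<theta>, \<theta>\<rangle>\<close> are the products of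
  \<open>A\<close> with the orthogonal projections onto the line through \<open>\<theta>\<close> and onto its orthogonal
  complement. These two projections are orthogonal to each other, with squared norms \<open>1\<close> and
  \<open>m = n - 1\<close>, so Bessel's inequality (\<open>hs_norm_ge_radial_plus_tangential\<close>) bounds the Hessian
  term. The gradient term is the Cauchy--Schwarz inequality \<open>u\<^sub>r\<^sup>2 \<le> |\<nabla>u|\<^sup>2\<close>.\<close>

lemma hs_norm_eq_norm: "hs_norm A = norm A"
proof -
  have "(hs_norm A)\<^sup>2 = A \<bullet> A"
    by (simp add: hs_norm_def inner_vec_def power2_eq_square sum_nonneg)
  moreover have "hs_norm A \<ge> 0"
    by (simp add: hs_norm_def sum_nonneg)
  ultimately show ?thesis
    by (metis norm_eq_sqrt_inner real_sqrt_unique)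
qed

text \<open>Bessel's inequality for two orthogonal vectors, with \<open>q\<close> left unnormalised because it will
  be the projection onto a hyperplane, whose squared norm \<open>m\<close> is the denominator in the theorem.\<close>

lemma bessel_two:
  fixes a p q :: "'a::real_inner"
  assumes "p \<bullet> p = 1" and "p \<bullet> q = 0" and "q \<noteq> 0"
  shows "(a \<bullet> p)\<^sup>2 + (a \<bullet> q)\<^sup>2 / (q \<bullet> q) \<le> (norm a)\<^sup>2"
proof -
  define s where "s = q \<bullet> q"
  have s: "s > 0" using assms(3) by (simp add: s_def)
  define c where "c = (a \<bullet> q) / s"
  have aq: "a \<bullet> q = c * s" using s by (simp add: c_def)
  (* the squared norm of the residual of a after projecting onto the span of p and q *)
  have "0 \<le> (a - (a \<bullet> p) *\<^sub>R p - c *\<^sub>R q) \<bullet> (a - (a \<bullet> p) *\<^sub>R p - c *\<^sub>R q)"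
    by simp
  also have "\<dots> = a \<bullet> a - (a \<bullet> p)\<^sup>2 - c * c * s"
    using assms aq
    by (simp add: inner_diff_left inner_diff_right inner_commute[of p a] inner_commute[of q a]
        inner_commute[of q p] s_def[symmetric] power2_eq_square algebra_simps)
  finally show ?thesis
    using s by (simp add: aq s_def[symmetric] power2_norm_eq_inner)
      (simp add: power2_eq_square)
qed

text \<open>The Hilbert--Schmidt products of \<open>A\<close> with \<open>\<theta>\<theta>\<^sup>T\<close> and with \<open>I - \<theta>\<theta>\<^sup>T\<close> are the two
  squared quantities on the left, and \<open>CARD('n) - 1\<close> is the squared norm of \<open>I - \<theta>\<theta>\<^sup>T\<close>, which is
  its rank. Dimension at least two makes this projection nonzero.\<close>

lemma hs_norm_ge_radial_plus_tangential:
  fixes A :: "real^'n^'n" and \<theta> :: "real^'n"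
  assumes "CARD('n) \<ge> 2" and "norm \<theta> = 1"
  shows "((A *v \<theta>) \<bullet> \<theta>)\<^sup>2 + (trace A - (A *v \<theta>) \<bullet> \<theta>)\<^sup>2 / real (CARD('n) - 1) \<le> (hs_norm A)\<^sup>2"
proof -
  (* projections onto the line through \<theta> and onto its orthogonal complement *)
  define T :: "real^'n^'n" where "T = (\<chi> i j. \<theta> $ i * \<theta> $ j)"
  define P :: "real^'n^'n" where "P = mat 1 - T"
  have BT: "B \<bullet> T = (B *v \<theta>) \<bullet> \<theta>" for B :: "real^'n^'n"
    by (simp add: T_def inner_vec_def matrix_vector_mult_def sum_distrib_left
        sum_distrib_right mult_ac)
  have B1: "B \<bullet> mat 1 = trace B" for B :: "real^'n^'n"
    by (simp add: inner_vec_def mat_def trace_def if_distrib cong: if_cong)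
  have \<theta>\<theta>: "\<theta> \<bullet> \<theta> = 1"
    using assms(2) by (simp add: norm_eq_1)
  have "T *v \<theta> = \<theta>"
    using \<theta>\<theta> by (simp add: T_def vec_eq_iff matrix_vector_mult_def inner_vec_def mult.assoc
        flip: sum_distrib_left)
  then have TT: "T \<bullet> T = 1"
    using \<theta>\<theta> by (simp add: BT)
  have T1: "T \<bullet> mat 1 = 1"
    using \<theta>\<theta> unfolding B1 by (simp add: trace_def T_def inner_vec_def)
  have TP: "T \<bullet> P = 0"
    using TT T1 by (simp add: P_def inner_diff_right)
  have "P \<bullet> P = P \<bullet> mat 1"
    using TP by (simp add: P_def inner_diff_right inner_commute)
  also have "\<dots> = real (CARD('n) - 1)"
    using T1 assms(1) by (simp add: P_def B1 trace_sub trace_I of_nat_diff)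
  finally have PP: "P \<bullet> P = real (CARD('n) - 1)" .
  have "P \<noteq> 0"
    using PP assms(1) by auto
  have "A \<bullet> P = trace A - (A *v \<theta>) \<bullet> \<theta>"
    by (simp add: P_def inner_diff_right BT B1)
  then show ?thesis
    using bessel_two[OF TT TP \<open>P \<noteq> 0\<close>, of A] by (simp only: PP hs_norm_eq_norm BT)
qed

theorem lemma6p1:
  fixes \<Omega> :: "(real^'n) set"
    and u g :: "real^'n \<Rightarrow> real"
    and Du :: "real^'n \<Rightarrow> real^'n"
    and D2u :: "real^'n \<Rightarrow> real^'n^'n"
    and m :: nat
  assumes "CARD('n) \<ge> 2"
    and "m = CARD('n) - 1"
    and "open \<Omega>"
    and "u \<in> H2_loc \<Omega>"
    and "weak_gradient \<Omega> u Du"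
    and "weak_hessian \<Omega> u D2u"
    and "AE x in lebesgue_on \<Omega>. OU Du D2u x = g x"
  shows "AE x in lebesgue_on \<Omega>.
    (hs_norm (D2u x))\<^sup>2 + (norm (Du x))\<^sup>2 \<ge>
      (radial_deriv2 D2u x)\<^sup>2 + (radial_deriv Du x)\<^sup>2 +
      (g x + norm x * radial_deriv Du x - radial_deriv2 D2u x)\<^sup>2 / real m"
proof -
  have "\<Omega> \<in> sets lebesgue"
    using assms(3) by auto
  (* the origin has no radial direction, but it is a null set *)
  moreover have "AE x in lebesgue. x \<noteq> (0 :: real^'n)"
    by (rule AE_I'[of "{0}"]) (auto simp: negligible_iff_null_sets[symmetric])
  ultimately have "AE x in lebesgue_on \<Omega>. x \<noteq> 0"
    by (subst AE_restrict_space_iff) auto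
  with assms(7) show ?thesis
  proof eventually_elim
    case (elim x)
    have \<theta>: "norm (sgn x) = 1"
      using elim(2) by (simp add: norm_sgn)
    have "x = norm x *\<^sub>R sgn x"
      using elim(2) by (simp add: sgn_div_norm)
    then have "x \<bullet> Du x = norm x * radial_deriv Du x"
      by (metis inner_commute inner_scaleR_left radial_deriv_def)
    then have Lu_plus_drift: "g x + norm x * radial_deriv Du x = trace (D2u x)"
      using elim(1) by (simp add: OU_def)
    have "\<bar>radial_deriv Du x\<bar> \<le> norm (Du x)"
      using Cauchy_Schwarz_ineq2[of "Du x" "sgn x"] \<theta> by (simp add: radial_deriv_def)
    then have "(radial_deriv Du x)\<^sup>2 \<le> (norm (Du x))\<^sup>2"
      by (simp add: abs_le_square_iff[symmetric])
    moreover have "(radial_deriv2 D2u x)\<^sup>2 + (trace (D2u x) - radial_deriv2 D2u x)\<^sup>2 / real m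
        \<le> (hs_norm (D2u x))\<^sup>2"
      using hs_norm_ge_radial_plus_tangential[OF assms(1) \<theta>, of "D2u x"]
      by (simp only: assms(2) radial_deriv2_def)
    ultimately show ?case
      unfolding Lu_plus_drift by linarith
  qed
qed

end
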